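(* Let $X$ be a 0DMC space, and $G$ be a graph on $X$. Then exactly one of the following holds: (1) $(X,G)$ has CCN at most two; (2) there is $\beta\in\mathcal{J}^c$ such that $(\mathbb{K}_\beta,\mathbb{G}_\beta)\preceq_c(X,G)$.
   Context: A space is 0DMC if it is zero-dimensional (has a basis of clopen sets), metrizable and compact. A digraph on $X$ is a binary relation $R\subseteq X^2$ disjoint from the diagonal; a graph is a symmetric digraph. The continuous chromatic number (CCN) of $(X,R)$ is the least cardinal $\kappa\leq\aleph_0$ for which there is a continuous map $c:X\to\kappa$ ($\kappa$ discrete) with $c(x)\neq c(y)$ whenever $(x,y)\in R$, if it exists, and $2^{\aleph_0}$ otherwise. $(X,R)\preceq_c(Y,S)$ means that there is a continuous $\varphi:X\to Y$ with $R\subseteq(\varphi\times\varphi)^{-1}(S)$. $s(R)=R\cup R^{-1}$, and $\mathrm{proj}[R]$ is the projection of $R$ on the first coordinate. Let $\mathcal{J}$ be the set of sequences $\beta=\big((s_l(i))_{i<\lambda_l}\big)_{l\in\omega}$ of finite sequences of finite binary words such that $(\lambda_l)_{l\in\omega}\in\omega^\omega$ is nondecreasing and unbounded and, for each $l\in\omega$, $\lambda_l>0$ is even and, for each $i<\lambda_l$, $s_l(i)\in\{0,1\}^{l+1}$. Let $\mathcal{J}^c$ be the set of $\beta\in\mathcal{J}$ such that, for each $i\in\omega$, the sequence $\big(s_l(i)0^\infty\big)_{l\in\omega,\lambda_l>i}$ converges in $2^\omega$. Let $c,a,\overline{a}$ be distinct letters not in $\omega$, and $\mathcal{K}=\{0,1,c,a,\overline{a}\}^\omega$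 with the product of discrete topologies; elements are written by concatenation. For $\beta\in\mathcal{J}$ put $$\mathbb{O}_\beta=\{(c^{l+1}a\overline{a}^\infty,\ s_l(0)\overline{a}a^\infty)\mid l\in\omega\}\cup\{(s_l(i)a^{i+1}\overline{a}^\infty,\ s_l(i+1)\overline{a}^{i+2}a^\infty)\mid l\in\omega,\ i\leq\lambda_l-2\}\cup\{(s_l(\lambda_l-1)a^{\lambda_l}\overline{a}^\infty,\ c^{l+1}\overline{a}a^\infty)\mid l\in\omega\},$$ $\mathbb{G}_\beta=s(\mathbb{O}_\beta)$, and let $\mathbb{K}_\beta$ be the closure of $\mathrm{proj}[\mathbb{G}_\beta]$ in $\mathcal{K}$; $\mathbb{G}_\beta$ is a graph on the 0DMC space $\mathbb{K}_\beta$. *)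

theory Defs
  imports "HOL-Analysis.Analysis" "HOL-Library.Extended_Nat" "HOL-Library.Omega_Words_Fun"
begin

definition zero_dimensional_space :: "'a topology \<Rightarrow> bool" where
  "zero_dimensional_space X \<longleftrightarrow>
     (\<exists>\<B>. (\<forall>U\<in>\<B>. openin X U \<and> closedin X U) \<and>
          openin X = arbitrary union_of (\<lambda>U. U \<in> \<B>))"

definition zero_dim_metrizable_compact :: "'a topology \<Rightarrow> bool" where
  "zero_dim_metrizable_compact X \<longleftrightarrow>
     zero_dimensional_space X \<and> metrizable_space X \<and> compact_space X"

definition digraph_on :: "'a topology \<Rightarrow> ('a \<times> 'a) set \<Rightarrow> bool" where
  "digraph_on X R \<longleftrightarrow> R \<subseteq> topspace X \<times> topspace X \<and> irrefl R"

definition graph_on :: "'a topology \<Rightarrow> ('a \<times> 'a) set \<Rightarrow> bool" where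
  "graph_on X R \<longleftrightarrow> digraph_on X R \<and> sym R"

text \<open>The cardinals up to \<open>\<aleph>\<^sub>0\<close> are represented by \<^typ>\<open>enat\<close>, the infinite one
  being \<open>\<infinity>\<close>; the set of colours \<open>{i. enat i < \<kappa>}\<close> is then the von Neumann ordinal \<open>\<kappa>\<close>.\<close>

definition continuously_colourable :: "'a topology \<Rightarrow> ('a \<times> 'a) set \<Rightarrow> enat \<Rightarrow> bool" where
  "continuously_colourable X R \<kappa> \<longleftrightarrow>
     (\<exists>c. continuous_map X (discrete_topology {i::nat. enat i < \<kappa>}) c \<and>
          (\<forall>(x, y)\<in>R. c x \<noteq> c y))"

text \<open>The continuous chromatic number as a cardinal in the sense of the library, that is, as a
  well-order. It lives over \<^typ>\<open>nat set\<close> to make room for \<open>2\<^sup>\<aleph>\<^sup>0\<close>; singletons embed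
  \<^typ>\<open>nat\<close> into \<^typ>\<open>nat set\<close>, so the first case has cardinality \<open>\<kappa>\<close>.\<close>

definition continuous_chromatic_number ::
    "'a topology \<Rightarrow> ('a \<times> 'a) set \<Rightarrow> (nat set \<times> nat set) set" where
  "continuous_chromatic_number X R =
     (if \<exists>\<kappa>. continuously_colourable X R \<kappa>
      then card_of ((\<lambda>i::nat. {i}) ` {i. enat i < (LEAST \<kappa>. continuously_colourable X R \<kappa>)})
      else card_of (UNIV :: nat set set))"

definition cont_reducible ::
    "'a topology \<Rightarrow> ('a \<times> 'a) set \<Rightarrow> 'b topology \<Rightarrow> ('b \<times> 'b) set \<Rightarrow> bool" where
  "cont_reducible X R Y S \<longleftrightarrow>
     (\<exists>\<phi>. continuous_map X Y \<phi> \<and> R \<subseteq> map_prod \<phi> \<phi> -` S)"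

text \<open>Binary words are lists of Booleans (\<^term>\<open>False\<close> is 0, \<^term>\<open>True\<close> is 1). For
  \<open>\<beta> :: nat \<Rightarrow> bool list list\<close>, \<^term>\<open>length (\<beta> l)\<close> is \<open>\<lambda>\<^sub>l\<close> and \<^term>\<open>\<beta> l ! i\<close> is \<open>s\<^sub>l(i)\<close>.\<close>

definition J_seqs :: "(nat \<Rightarrow> bool list list) set" where
  "J_seqs = {\<beta>. mono (\<lambda>l. length (\<beta> l)) \<and> (\<forall>n. \<exists>l. n < length (\<beta> l)) \<and>
            (\<forall>l. 0 < length (\<beta> l) \<and> even (length (\<beta> l)) \<and>
                 (\<forall>i < length (\<beta> l). length (\<beta> l ! i) = l + 1))}"

definition cantor_topology :: "(nat \<Rightarrow> bool) topology" where
  "cantor_topology = product_topology (\<lambda>_. discrete_topology UNIV) UNIV"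

text \<open>The filter restricts \<open>l \<longrightarrow> \<infinity>\<close> to the indices \<open>l\<close> for which \<open>s\<^sub>l(i)\<close> exists.\<close>

definition J_conv :: "(nat \<Rightarrow> bool list list) set" where
  "J_conv = {\<beta> \<in> J_seqs. \<forall>i. \<exists>x. limitin cantor_topology (\<lambda>l. (\<beta> l ! i) \<frown> (\<lambda>_. False)) x
                          (inf sequentially (principal {l. i < length (\<beta> l)}))}"

text \<open>The letter a with a bar is written \<open>La_bar\<close>.\<close>

datatype letter = Bit bool | Lc | La | La_bar

definition K_space :: "(nat \<Rightarrow> letter) topology" where
  "K_space = product_topology (\<lambda>_. discrete_topology UNIV) UNIV"

definition O_rel :: "(nat \<Rightarrow> bool list list) \<Rightarrow> ((nat \<Rightarrow> letter) \<times> (nat \<Rightarrow> letter)) set" where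
  "O_rel \<beta> =
     {((replicate (l + 1) Lc @ [La]) \<frown> (\<lambda>_. La_bar),
       (map Bit (\<beta> l ! 0) @ [La_bar]) \<frown> (\<lambda>_. La)) | l. True} \<union>
     {((map Bit (\<beta> l ! i) @ replicate (i + 1) La) \<frown> (\<lambda>_. La_bar),
       (map Bit (\<beta> l ! (i + 1)) @ replicate (i + 2) La_bar) \<frown> (\<lambda>_. La))
       | l i. i + 2 \<le> length (\<beta> l)} \<union>
     {((map Bit (\<beta> l ! (length (\<beta> l) - 1)) @ replicate (length (\<beta> l)) La) \<frown> (\<lambda>_. La_bar),
       (replicate (l + 1) Lc @ [La_bar]) \<frown> (\<lambda>_. La)) | l. True}"

definition G_rel :: "(nat \<Rightarrow> bool list list) \<Rightarrow> ((nat \<Rightarrow> letter) \<times> (nat \<Rightarrow> letter)) set" where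
  "G_rel \<beta> = O_rel \<beta> \<union> (O_rel \<beta>)\<inverse>"

definition K_subspace :: "(nat \<Rightarrow> bool list list) \<Rightarrow> (nat \<Rightarrow> letter) topology" where
  "K_subspace \<beta> = subtopology K_space (K_space closure_of (fst ` G_rel \<beta>))"

end

theory Submission
  imports Defs "HOL-Library.Diagonal_Subsequence"
begin

text \<open>The graph \<open>\<G>\<^sub>\<beta>\<close> is a sequence of odd cycles, one for each \<open>l\<close>, in which every vertex has been
  split into two points that agree on the first \<open>l + 1\<close> coordinates; no edge connects different
  cycles. Such a graph has no continuous two-colouring: \<open>\<K>\<^sub>\<beta>\<close> is compact, so the colour of a point
  depends on a prefix of fixed length, and for large \<open>l\<close> the colouring descends to an honest odd
  cycle (\<open>K_subspace_not_two_colourable\<close>). A continuous homomorphism into \<open>G\<close> pulls colourings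
  back, so the two alternatives exclude each other.

  Conversely, let \<open>X\<close> be a closed subset of the Cantor space, which is no restriction
  (\<open>zero_dim_metrizable_compact_embeds_in_cantor\<close>). If \<open>G\<close> has no continuous two-colouring, then
  for no \<open>l\<close> is there one that reads only the first \<open>l + 1\<close> bits. So the quotient of \<open>G\<close>
  on words of length \<open>l + 1\<close> is not bipartite and contains an odd closed walk, that is, \<open>G\<close> has
  a cyclic sequence of edges, odd in number, such that each edge starts in the cylinder of length
  \<open>l + 1\<close> where the preceding edge ends (\<open>two_colouring_or_odd_pseudo_cycle\<close>). The words of these
  cylinders are taken as \<open>\<beta>\<close>. The first one is replaced by the letters c: it serves as
  the base point of the cycle.

  The required map sends the two halves of a split vertex to the ends of the corresponding edges
  of \<open>G\<close>. The vertices are isolated points of \<open>\<K>\<^sub>\<beta>\<close>, and the only other points are sequences of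
  bits and the constant sequence c. A vertex close to a sequence of bits begins with a
  long prefix of it and so does its image, so the map extends continuously by the identity to the
  sequences of bits. It remains to make the base points converge, so that the constant
  sequence c can be sent to their limit; a subsequence of the cycles does this, and the same
  diagonal choice gives the convergence that membership in \<open>\<J>\<^sup>c\<close> asks for.\<close>

section \<open>Spaces of sequences over a discrete alphabet\<close>

abbreviation seq_space :: "(nat \<Rightarrow> 'b) topology" where
  "seq_space \<equiv> product_topology (\<lambda>_. discrete_topology UNIV) UNIV"

definition cylinder :: "nat \<Rightarrow> (nat \<Rightarrow> 'b) \<Rightarrow> (nat \<Rightarrow> 'b) set" where
  "cylinder n x = {y. \<forall>k<n. y k = x k}"

lemma in_cylinderD: "y \<in> cylinder n x \<Longrightarrow> k < n \<Longrightarrow> y k = x k"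
  by (simp add: cylinder_def)

lemma self_in_cylinder [simp]: "x \<in> cylinder n x"
  by (simp add: cylinder_def)

lemma cylinder_cong: "y \<in> cylinder n x \<Longrightarrow> cylinder n y = cylinder n x"
  by (auto simp: cylinder_def)

lemma openin_seq_space_iff:
  "openin seq_space U \<longleftrightarrow> (\<forall>x\<in>U. \<exists>n. cylinder n x \<subseteq> U)"
proof (intro iffI ballI)
  fix x assume "openin seq_space U" "x \<in> U"
  then obtain V where "finite {i \<in> UNIV. V i \<noteq> topspace (discrete_topology (UNIV :: 'a set))}"
      "x \<in> Pi\<^sub>E UNIV V" "Pi\<^sub>E UNIV V \<subseteq> U"
    unfolding openin_product_topology_alt by blast
  then have V: "finite {i. V i \<noteq> UNIV}" "\<And>i. x i \<in> V i" "Pi UNIV V \<subseteq> U"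
    by (simp_all add: PiE_UNIV_domain Pi_iff)
  obtain n where n: "\<And>i. V i \<noteq> UNIV \<Longrightarrow> i < n"
    using finite_nat_set_iff_bounded V(1) by auto
  have "y \<in> U" if y: "y \<in> cylinder n x" for y
  proof -
    have "y i \<in> V i" for i
      using n[of i] V(2)[of i] in_cylinderD[OF y, of i] by (cases "V i = UNIV") auto
    then have "y \<in> Pi UNIV V" by simp
    then show ?thesis using V(3) by blast
  qed
  then show "\<exists>n. cylinder n x \<subseteq> U" by blast
next
  assume *: "\<forall>x\<in>U. \<exists>n. cylinder n x \<subseteq> U"
  show "openin seq_space U"
    unfolding openin_product_topology_alt
  proof
    fix x assume "x \<in> U"
    then obtain n where n: "cylinder n x \<subseteq> U" using * by blast
    let ?V = "\<lambda>i. if i < n then {x i} else UNIV"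
    have "finite {i. ?V i \<noteq> UNIV}"
      by (rule finite_subset[of _ "{..<n}"]) auto
    moreover have "Pi UNIV ?V = cylinder n x"
      by (auto simp: cylinder_def Pi_iff split: if_splits)
    ultimately show "\<exists>V. finite {i \<in> UNIV. V i \<noteq> topspace (discrete_topology UNIV)} \<and>
        (\<forall>i\<in>UNIV. openin (discrete_topology UNIV) (V i)) \<and> x \<in> Pi\<^sub>E UNIV V \<and> Pi\<^sub>E UNIV V \<subseteq> U"
      using n by (intro exI[of _ ?V]) (simp add: PiE_UNIV_domain)
  qed
qed

lemma openin_cylinder: "openin seq_space (cylinder n x)"
  unfolding openin_seq_space_iff
proof
  fix y assume "y \<in> cylinder n x"
  then show "\<exists>m. cylinder m y \<subseteq> cylinder n x"
    using cylinder_cong[of y n x] by (intro exI[of _ n]) simp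
qed

lemma in_closure_of_seq_space:
  "z \<in> seq_space closure_of D \<longleftrightarrow> (\<forall>n. \<exists>v\<in>D. v \<in> cylinder n z)"
proof
  assume "z \<in> seq_space closure_of D"
  then show "\<forall>n. \<exists>v\<in>D. v \<in> cylinder n z"
    using openin_cylinder self_in_cylinder unfolding in_closure_of by metis
next
  assume *: "\<forall>n. \<exists>v\<in>D. v \<in> cylinder n z"
  have "\<exists>y. y \<in> D \<and> y \<in> T" if "z \<in> T \<and> openin seq_space T" for T
  proof -
    have "\<exists>n. cylinder n z \<subseteq> T" using that by (simp add: openin_seq_space_iff)
    then obtain n where "cylinder n z \<subseteq> T" by (rule exE)
    then show ?thesis using * by blast
  qed
  then show "z \<in> seq_space closure_of D" unfolding in_closure_of by simp
qed

lemma continuous_map_seq_spaceI: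
  assumes "\<And>z j. z \<in> C \<Longrightarrow> \<exists>n. \<forall>z' \<in> C \<inter> cylinder n z. f z' j = f z j"
  shows "continuous_map (subtopology seq_space C) seq_space f"
  unfolding continuous_map_componentwise_UNIV
proof
  fix j
  obtain n where n: "\<And>z z'. z \<in> C \<Longrightarrow> z' \<in> C \<inter> cylinder (n z) z \<Longrightarrow> f z' j = f z j"
    using assms[of _ j] by metis
  have "openin (subtopology seq_space C) {x \<in> C. f x j \<in> U}" for U
  proof -
    define W where "W = (\<Union>z\<in>{x \<in> C. f x j \<in> U}. cylinder (n z) z)"
    have "openin seq_space W" unfolding W_def using openin_cylinder by blast
    moreover have "{x \<in> C. f x j \<in> U} = W \<inter> C"
    proof (intro equalityI subsetI)
      fix x assume "x \<in> W \<inter> C"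
      then obtain z where z: "z \<in> C" "f z j \<in> U" "x \<in> C \<inter> cylinder (n z) z"
        unfolding W_def by blast
      then have "f x j = f z j" using n by metis
      then show "x \<in> {x \<in> C. f x j \<in> U}" using z by simp
    next
      fix x assume "x \<in> {x \<in> C. f x j \<in> U}"
      moreover have "x \<in> cylinder (n x) x" by simp
      ultimately show "x \<in> W \<inter> C" unfolding W_def by blast
    qed
    ultimately show ?thesis unfolding openin_subtopology by metis
  qed
  then show "continuous_map (subtopology seq_space C) (discrete_topology UNIV) (\<lambda>x. f x j)"
    unfolding continuous_map by simp
qed

lemma compact_seq_space:
  assumes "finite (UNIV :: 'b set)"
  shows "compact_space (seq_space :: (nat \<Rightarrow> 'b) topology)"
  using assms by (simp add: compact_space_product_topology compact_space_discrete_topology)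

text \<open>This is uniform continuity: compactness yields one length that works at every point.\<close>

lemma discrete_map_depends_on_prefix:
  assumes C: "compactin seq_space C"
    and f: "continuous_map (subtopology seq_space C) (discrete_topology S) f"
  shows "\<exists>n. \<forall>x\<in>C. \<forall>y \<in> C \<inter> cylinder n x. f y = f x"
proof -
  have "\<exists>n. \<forall>y \<in> C \<inter> cylinder n x. f y = f x" if x: "x \<in> C" for x
  proof -
    have "f x \<in> S" using f x unfolding continuous_map by auto
    then have "openin (discrete_topology S) {f x}" by simp
    then have "openin (subtopology seq_space C) {y \<in> topspace (subtopology seq_space C). f y \<in> {f x}}"
      by (rule openin_continuous_map_preimage[OF f])
    then obtain W where W: "openin seq_space W"
      "{y \<in> topspace (subtopology seq_space C). f y \<in> {f x}} = W \<inter> C"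
      by (rule openin_subtopology[THEN iffD1, elim_format]) blast
    then have W': "{y \<in> C. f y = f x} = W \<inter> C" by simp
    with x have "x \<in> W" by blast
    with W(1) obtain n where "cylinder n x \<subseteq> W"
      using openin_seq_space_iff[of W] by blast
    then show ?thesis using W' by blast
  qed
  then obtain n where n: "\<And>x y. x \<in> C \<Longrightarrow> y \<in> C \<inter> cylinder (n x) x \<Longrightarrow> f y = f x"
    by metis
  have "C \<subseteq> \<Union>((\<lambda>x. cylinder (n x) x) ` C)"
  proof
    fix x assume "x \<in> C"
    moreover have "x \<in> cylinder (n x) x" by simp
    ultimately show "x \<in> \<Union>((\<lambda>x. cylinder (n x) x) ` C)" by blast
  qed
  moreover have "\<forall>U \<in> (\<lambda>x. cylinder (n x) x) ` C. openin seq_space U"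
    using openin_cylinder by blast
  ultimately obtain \<F> where "finite \<F>" "\<F> \<subseteq> (\<lambda>x. cylinder (n x) x) ` C" "C \<subseteq> \<Union>\<F>"
    using compactinD[OF C, of "(\<lambda>x. cylinder (n x) x) ` C"] by blast
  then obtain A where A: "finite A" "A \<subseteq> C" "C \<subseteq> (\<Union>x\<in>A. cylinder (n x) x)"
    using finite_subset_image[of \<F> "\<lambda>x. cylinder (n x) x" C] by blast
  have "f y = f x" if xy: "x \<in> C" "y \<in> C" "y \<in> cylinder (Max (n ` A)) x" for x y
  proof -
    obtain a where a: "a \<in> A" "x \<in> cylinder (n a) a" using A(3) xy(1) by blast
    then have "n a \<le> Max (n ` A)" using A(1) by simp
    then have "y \<in> cylinder (n a) x" using xy(3) by (simp add: cylinder_def)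
    then have "y \<in> cylinder (n a) a" using cylinder_cong[OF a(2)] by simp
    then have "f y = f a" using n[of a y] a(1) A(2) xy(2) by blast
    also have "f a = f x" using n[of a x] a A(2) xy(1) by auto
    finally show ?thesis .
  qed
  then show ?thesis by blast
qed

text \<open>Sequential compactness of the Cantor space; in the two-point space, convergence means being
  eventually constant.\<close>

lemma pointwise_eventually_constant_subsequence:
  fixes w :: "nat \<Rightarrow> 'b::countable \<Rightarrow> bool"
  shows "\<exists>r. strict_mono (r :: nat \<Rightarrow> nat) \<and> (\<forall>k. \<exists>b. \<forall>\<^sub>F l in sequentially. w (r l) k = b)"
proof -
  let ?P = "\<lambda>n s. \<exists>b. \<forall>\<^sub>F l in sequentially. w (s l) (from_nat n) = b"
  interpret subseqs ?P
  proof
    fix n and s :: "nat \<Rightarrow> nat"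
    obtain b where "infinite {l. w (s l) (from_nat n) = b}"
    proof (cases "infinite {l. w (s l) (from_nat n) = True}")
      case False
      then have "infinite (UNIV - {l. w (s l) (from_nat n) = True})"
        using Diff_infinite_finite infinite_UNIV_nat by blast
      then show ?thesis using that[of False] by (simp add: Compl_eq_Diff_UNIV[symmetric] Collect_neg_eq)
    qed (use that in blast)
    then obtain r :: "nat \<Rightarrow> nat" where r: "strict_mono r" "\<forall>l. r l \<in> {l. w (s l) (from_nat n) = b}"
      using infinite_enumerate by blast
    then have "?P n (s \<circ> r)" by (intro exI[of _ b]) simp
    then show "\<exists>r. strict_mono r \<and> ?P n (s \<circ> r)" using r(1) by (intro exI[of _ r] conjI)
  qed
  have stable: "?P n (s \<circ> r)" if r: "strict_mono r" and s: "?P n s" for r s :: "nat \<Rightarrow> nat" and n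
  proof -
    obtain b where "\<forall>\<^sub>F l in sequentially. w (s l) (from_nat n) = b" using s by (rule exE)
    from eventually_subseq[OF r this] show ?thesis by (intro exI[of _ b]) simp
  qed
  have "\<exists>b. \<forall>\<^sub>F l in sequentially. w (diagseq l) k = b" for k
  proof -
    obtain b where b: "\<forall>\<^sub>F l in sequentially. w ((diagseq \<circ> (+) (Suc (to_nat k))) l) k = b"
      using diagseq_holds[OF stable, of "to_nat k"] by auto
    then have "\<forall>\<^sub>F l in sequentially. w (diagseq (l + Suc (to_nat k))) k = b"
      by (simp add: add.commute)
    then have "\<forall>\<^sub>F l in sequentially. w (diagseq l) k = b"
      by (rule eventually_sequentially_seg[THEN iffD1])
    then show ?thesis by blast
  qed
  then show ?thesis using subseq_diagseq by blast
qed


section \<open>Embedding into the Cantor space\<close>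

text \<open>At each scale \<open>1/n\<close> compactness gives a finite clopen cover by small sets. These covers
  together form a countable family of clopen sets that separates points, and membership in its
  members gives the coordinates of an embedding.\<close>

lemma zero_dim_metrizable_compact_embeds_in_cantor:
  assumes "zero_dim_metrizable_compact X"
  shows "\<exists>e. embedding_map X cantor_topology e \<and> closedin cantor_topology (e ` topspace X)"
proof -
  obtain \<B> where \<B>: "\<And>U. U \<in> \<B> \<Longrightarrow> openin X U \<and> closedin X U"
      "openin X = arbitrary union_of (\<lambda>U. U \<in> \<B>)"
    using assms unfolding zero_dim_metrizable_compact_def zero_dimensional_space_def by blast
  obtain M d where M: "Metric_space M d" "X = Metric_space.mtopology M d"
    using assms unfolding zero_dim_metrizable_compact_def metrizable_space_def by blast
  interpret Metric_space M d by fact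
  have top: "topspace X = M" using M by simp
  have comp: "compact_space X" using assms unfolding zero_dim_metrizable_compact_def by blast
  have "\<exists>\<F>. finite \<F> \<and> \<F> \<subseteq> \<B> \<and> M \<subseteq> \<Union>\<F> \<and> (\<forall>U\<in>\<F>. \<exists>x. U \<subseteq> mball x (1 / Suc n))" for n
  proof -
    let ?\<U> = "{U \<in> \<B>. \<exists>x. U \<subseteq> mball x (1 / Suc n)}"
    have "x \<in> \<Union>?\<U>" if "x \<in> M" for x
    proof -
      have "openin X (mball x (1 / Suc n))" using M(2) by simp
      moreover have "x \<in> mball x (1 / Suc n)" using that by simp
      ultimately show ?thesis
        unfolding \<B>(2) arbitrary_union_of_alt by blast
    qed
    then have "topspace X \<subseteq> \<Union>?\<U>" using top by blast
    moreover have "\<forall>U\<in>?\<U>. openin X U" using \<B>(1) by blast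
    ultimately obtain \<F> where "finite \<F>" "\<F> \<subseteq> ?\<U>" "topspace X \<subseteq> \<Union>\<F>"
      using comp unfolding compact_space_alt by (metis (no_types, lifting))
    then show ?thesis using top by blast
  qed
  then obtain \<F> where \<F>: "\<And>n. finite (\<F> n)" "\<And>n. \<F> n \<subseteq> \<B>" "\<And>n. M \<subseteq> \<Union>(\<F> n)"
      "\<And>n U. U \<in> \<F> n \<Longrightarrow> \<exists>x. U \<subseteq> mball x (1 / Suc n)" by metis
  \<comment> \<open>The empty set ensures that there is something to enumerate when \<open>X\<close> is empty.\<close>
  define \<C> where "\<C> = insert {} (\<Union>n. \<F> n)"
  have "countable \<C>" unfolding \<C>_def using \<F>(1) by (simp add: countable_finite)
  define e where "e = (\<lambda>x n. x \<in> from_nat_into \<C> n)"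
  have mem: "from_nat_into \<C> n \<in> \<C>" for n by (rule from_nat_into) (simp add: \<C>_def)
  have clopen: "openin X U" "closedin X U" if "U \<in> \<C>" for U
    using that \<F>(2) \<B>(1) unfolding \<C>_def by (metis UN_E insertE openin_empty subsetD, metis UN_E insertE closedin_empty subsetD)
  have cont: "continuous_map X cantor_topology e"
    unfolding cantor_topology_def continuous_map_componentwise_UNIV
  proof
    fix n
    let ?U = "from_nat_into \<C> n"
    have "openin X ?U" "closedin X ?U" using clopen mem by blast+
    then have "openin X (topspace X - ?U)" by blast
    have "openin X {x \<in> topspace X. e x n \<in> V}" for V
    proof -
      have eq: "{x \<in> topspace X. e x n \<in> V} =
          (if True \<in> V then ?U else {}) \<union> (if False \<in> V then topspace X - ?U else {})"
      proof (rule set_eqI)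
        fix x
        show "x \<in> {x \<in> topspace X. e x n \<in> V} \<longleftrightarrow>
            x \<in> (if True \<in> V then ?U else {}) \<union> (if False \<in> V then topspace X - ?U else {})"
          using openin_subset[OF \<open>openin X ?U\<close>] by (cases "x \<in> ?U") (auto simp: e_def)
      qed
      show ?thesis
        unfolding eq using \<open>openin X ?U\<close> \<open>openin X (topspace X - ?U)\<close>
        by (intro openin_Un) simp_all
    qed
    then show "continuous_map X (discrete_topology UNIV) (\<lambda>x. e x n)"
      unfolding continuous_map by auto
  qed
  have inj: "inj_on e (topspace X)"
  proof (rule inj_onI, rule ccontr)
    fix x y assume xy: "x \<in> topspace X" "y \<in> topspace X" "e x = e y" "x \<noteq> y"
    then have "x \<in> M" "y \<in> M" "d x y > 0" using top by auto
    then obtain n where n: "1 / Suc n < d x y / 2" using nat_approx_posE[of "d x y / 2"] by auto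
    obtain U where U: "U \<in> \<F> n" "x \<in> U" using \<F>(3) \<open>x \<in> M\<close> by blast
    then obtain m where m: "from_nat_into \<C> m = U"
      using from_nat_into_surj[OF \<open>countable \<C>\<close>] unfolding \<C>_def by blast
    then have "y \<in> U" using xy(3) U(2) unfolding e_def by metis
    then obtain z where z: "x \<in> mball z (1 / Suc n)" "y \<in> mball z (1 / Suc n)"
      using \<F>(4)[OF U(1)] U(2) by blast
    then have "d z x < 1 / Suc n" "d z y < 1 / Suc n" "z \<in> M" by auto
    then show False using triangle[of x z y] n commute[of x z] \<open>x \<in> M\<close> \<open>y \<in> M\<close> by linarith
  qed
  have haus: "Hausdorff_space cantor_topology"
    unfolding cantor_topology_def by (simp add: Hausdorff_space_product_topology)
  have "embedding_map X cantor_topology e"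
    using continuous_imp_embedding_map[OF cont comp haus inj] .
  moreover have "closedin cantor_topology (e ` topspace X)"
    using compactin_imp_closedin[OF haus] image_compactin[OF _ cont] comp
    unfolding compact_space_def by blast
  ultimately show ?thesis by blast
qed


section \<open>Odd closed walks\<close>

text \<open>Colour each point by the parity of a walk that reaches it from a chosen representative of
  its component. The colouring fails only if two walks of different parity reach the same point,
  and then these two walks close up to an odd one.\<close>

lemma two_colouring_or_odd_closed_walk:
  assumes "sym E"
  shows "(\<exists>c :: 'b \<Rightarrow> bool. \<forall>(u, v)\<in>E. c u \<noteq> c v) \<or> (\<exists>a n. odd n \<and> (a, a) \<in> E ^^ n)"
proof (rule disjCI)
  assume none: "\<nexists>a n. odd n \<and> (a, a) \<in> E ^^ n"
  define rep where "rep u = (SOME v. (v, u) \<in> E\<^sup>*)" for u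
  have rep: "(rep u, u) \<in> E\<^sup>*" for u
    unfolding rep_def by (rule someI[of _ u]) simp
  define c where "c u \<longleftrightarrow> (\<exists>n. even n \<and> (rep u, u) \<in> E ^^ n)" for u
  have symE: "(b, a) \<in> E ^^ n" if "(a, b) \<in> E ^^ n" for a b n
    using that assms
  proof (induction n arbitrary: b)
    case (Suc n)
    then obtain z where z: "(a, z) \<in> E ^^ n" "(z, b) \<in> E" by auto
    then have "(z, a) \<in> E ^^ n" "(b, z) \<in> E" using Suc symD[OF assms] by blast+
    then show ?case using relpow_Suc_I2 by metis
  qed simp
  have "c u \<noteq> c v" if uv: "(u, v) \<in> E" for u v
  proof -
    have vu: "(v, u) \<in> E" using uv assms by (rule symD[rotated])
    have "(x, u) \<in> E\<^sup>* \<longleftrightarrow> (x, v) \<in> E\<^sup>*" for x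
      using uv vu by (meson rtrancl.rtrancl_into_rtrancl)
    then have eq: "rep u = rep v" unfolding rep_def by simp
    show ?thesis
    proof
      assume "c u = c v"
      show False
      proof (cases "c u")
        case True
        then obtain m n where mn: "even m" "(rep u, u) \<in> E ^^ m" "even n" "(rep u, v) \<in> E ^^ n"
          using \<open>c u = c v\<close> eq unfolding c_def by auto
        then have "(rep u, rep u) \<in> E ^^ (Suc m + n)"
          using uv symE[OF mn(4)] unfolding relpow_add by auto
        moreover have "odd (Suc m + n)" using mn by simp
        ultimately show False using none by blast
      next
        case False
        obtain n where n: "(rep u, u) \<in> E ^^ n" using rtrancl_imp_relpow[OF rep[of u]] by blast
        then have "(rep v, v) \<in> E ^^ Suc n" using uv eq by auto
        then show False using n False \<open>c u = c v\<close> unfolding c_def by (metis even_Suc)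
      qed
    qed
  qed
  then show "\<exists>c :: 'b \<Rightarrow> bool. \<forall>(u, v)\<in>E. c u \<noteq> c v" by blast
qed

text \<open>A closed walk is lengthened by going back and forth along an edge.\<close>

lemma closed_walk_lengthen:
  assumes "sym E" "(a, a) \<in> E ^^ n" "0 < n"
  shows "(a, a) \<in> E ^^ (n + 2 * k)"
proof (induction k)
  case (Suc k)
  obtain b where "(a, b) \<in> E" using assms(2,3) by (metis gr0_conv_Suc relpow_Suc_D2)
  then have "(b, a) \<in> E" by (rule symD[OF assms(1)])
  then have "(a, a) \<in> E ^^ Suc (Suc (n + 2 * k))" using Suc \<open>(a, b) \<in> E\<close> by auto
  then show ?case by simp
qed (use assms in simp)

text \<open>If \<open>G\<close> has no colouring that factors through \<open>p\<close>, its image under \<open>p\<close> has an odd closed walk,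
  possibly a loop. A closed walk in the image lifts to a closed sequence of edges of \<open>G\<close>, in which an
  edge starts in the fibre of \<open>p\<close> where the preceding one ends.\<close>

lemma two_colouring_or_odd_pseudo_cycle:
  fixes p :: "'a \<Rightarrow> 'b"
  assumes "sym G"
    and "\<nexists>c :: 'b \<Rightarrow> bool. \<forall>(u, v)\<in>G. c (p u) \<noteq> c (p v)"
  shows "\<exists>N. odd N \<and> (\<forall>k. \<exists>x y. \<forall>i < N + 2 * k.
           (x i, y i) \<in> G \<and> p (y i) = p (x (Suc i mod (N + 2 * k))))"
proof -
  let ?E = "map_prod p p ` G"
  have "sym ?E" using assms(1) by (auto simp: sym_def)
  moreover have "\<not> (\<exists>c :: 'b \<Rightarrow> bool. \<forall>(u, v)\<in>?E. c u \<noteq> c v)"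
  proof
    assume "\<exists>c :: 'b \<Rightarrow> bool. \<forall>(u, v)\<in>?E. c u \<noteq> c v"
    then obtain c :: "'b \<Rightarrow> bool" where "\<forall>(u, v)\<in>?E. c u \<noteq> c v" by (rule exE)
    then have "\<forall>(u, v)\<in>G. c (p u) \<noteq> c (p v)" by auto
    then have "\<exists>c :: 'b \<Rightarrow> bool. \<forall>(u, v)\<in>G. c (p u) \<noteq> c (p v)" by (rule exI[of _ c])
    with assms(2) show False by (rule notE)
  qed
  ultimately obtain a N where aN: "odd N" "(a, a) \<in> ?E ^^ N"
    using two_colouring_or_odd_closed_walk[of ?E] by blast
  have "\<exists>x y. \<forall>i < N + 2 * k. (x i, y i) \<in> G \<and> p (y i) = p (x (Suc i mod (N + 2 * k)))" for k
  proof -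
    let ?L = "N + 2 * k"
    have "0 < ?L" using aN(1) by (simp add: odd_pos)
    have "(a, a) \<in> ?E ^^ ?L"
      using closed_walk_lengthen[OF \<open>sym ?E\<close> aN(2)] aN(1) odd_pos by blast
    then obtain f where f: "f 0 = a" "f ?L = a" "\<And>i. i < ?L \<Longrightarrow> (f i, f (Suc i)) \<in> ?E"
      unfolding relpow_fun_conv by blast
    then have "\<forall>i. \<exists>x y. i < ?L \<longrightarrow> (x, y) \<in> G \<and> p x = f i \<and> p y = f (Suc i)" by fastforce
    then obtain x y where xy: "\<And>i. i < ?L \<Longrightarrow> (x i, y i) \<in> G \<and> p (x i) = f i \<and> p (y i) = f (Suc i)"
      by metis
    have "p (y i) = p (x (Suc i mod ?L))" if "i < ?L" for i
    proof (cases "Suc i = ?L")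
      case True
      then have "p (y i) = f ?L" using xy[OF that] by metis
      then show ?thesis using True xy[of 0] f \<open>0 < ?L\<close> by simp
    next
      case False
      then show ?thesis using xy[of i] xy[of "Suc i"] that by simp
    qed
    then show ?thesis using xy by blast
  qed
  then show ?thesis using aN(1) by blast
qed


section \<open>The graph as a sequence of odd cycles with split vertices\<close>

text \<open>The \<open>l\<close>-th block of edges is a cycle of odd length \<open>\<lambda>\<^sub>l + 1\<close> with vertices
  \<open>0, \<dots>, \<lambda>\<^sub>l\<close> (vertex 0 being the one with the letter c), in which every vertex is split into two
  points that agree on the first \<open>l + 1\<close> coordinates: \<open>b\<close> says whether an edge leaves the
  point or enters it. The prefix and the constant tail are separated by \<open>i\<close> copies of the other
  letter, except that vertex 0 has one copy as well.\<close>

definition vertex :: "(nat \<Rightarrow> bool list list) \<Rightarrow> nat \<Rightarrow> nat \<Rightarrow> bool \<Rightarrow> nat \<Rightarrow> letter" where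
  "vertex \<beta> l i b n =
     (if n \<le> l then if i = 0 then Lc else Bit (\<beta> l ! (i - 1) ! n)
      else if (n \<le> l + max 1 i) = b then La else La_bar)"

lemma vertex_c_eq_conc:
  "(replicate (l + 1) Lc @ [La]) \<frown> (\<lambda>_. La_bar) = vertex \<beta> l 0 True"
  "(replicate (l + 1) Lc @ [La_bar]) \<frown> (\<lambda>_. La) = vertex \<beta> l 0 False"
  by (auto simp: fun_eq_iff conc_def nth_append vertex_def nth_Cons')

lemma vertex_bits_eq_conc:
  assumes "length (\<beta> l ! i) = l + 1"
  shows "(map Bit (\<beta> l ! i) @ replicate (i + 1) La) \<frown> (\<lambda>_. La_bar) = vertex \<beta> l (Suc i) True"
    and "(map Bit (\<beta> l ! i) @ replicate (i + 1) La_bar) \<frown> (\<lambda>_. La) = vertex \<beta> l (Suc i) False"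
  using assms by (auto simp: fun_eq_iff conc_def nth_append vertex_def nth_Cons')

lemma O_rel_eq:
  assumes "\<beta> \<in> J_seqs"
  shows "O_rel \<beta> = {(vertex \<beta> l i True, vertex \<beta> l (Suc i mod Suc (length (\<beta> l))) False) | l i.
           i \<le> length (\<beta> l)}" (is "_ = ?R")
proof -
  have len: "\<And>l i. i < length (\<beta> l) \<Longrightarrow> length (\<beta> l ! i) = l + 1" and pos: "\<And>l. 0 < length (\<beta> l)"
    using assms unfolding J_seqs_def by auto
  have first: "((replicate (l + 1) Lc @ [La]) \<frown> (\<lambda>_. La_bar),
       (map Bit (\<beta> l ! 0) @ [La_bar]) \<frown> (\<lambda>_. La)) = (vertex \<beta> l 0 True, vertex \<beta> l 1 False)" for l
    using vertex_c_eq_conc(1)[of l \<beta>] vertex_bits_eq_conc(2)[of \<beta> l 0] len[of 0 l] pos[of l] by simp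
  have mid: "((map Bit (\<beta> l ! i) @ replicate (i + 1) La) \<frown> (\<lambda>_. La_bar),
       (map Bit (\<beta> l ! (i + 1)) @ replicate (i + 2) La_bar) \<frown> (\<lambda>_. La)) =
       (vertex \<beta> l (Suc i) True, vertex \<beta> l (Suc (Suc i)) False)" if "i + 2 \<le> length (\<beta> l)" for l i
    using vertex_bits_eq_conc(1)[of \<beta> l i] vertex_bits_eq_conc(2)[of \<beta> l "Suc i"]
      len[of i l] len[of "Suc i" l] that by simp
  have last: "((map Bit (\<beta> l ! (length (\<beta> l) - 1)) @ replicate (length (\<beta> l)) La) \<frown> (\<lambda>_. La_bar),
       (replicate (l + 1) Lc @ [La_bar]) \<frown> (\<lambda>_. La)) =
       (vertex \<beta> l (length (\<beta> l)) True, vertex \<beta> l 0 False)" for l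
    using vertex_c_eq_conc(2)[of l \<beta>] vertex_bits_eq_conc(1)[of \<beta> l "length (\<beta> l) - 1"]
      len[of "length (\<beta> l) - 1" l] pos[of l] by (cases "length (\<beta> l)") simp_all
  have "O_rel \<beta> = {(vertex \<beta> l 0 True, vertex \<beta> l 1 False) | l. True} \<union>
      {(vertex \<beta> l (Suc i) True, vertex \<beta> l (Suc (Suc i)) False) | l i. i + 2 \<le> length (\<beta> l)} \<union>
      {(vertex \<beta> l (length (\<beta> l)) True, vertex \<beta> l 0 False) | l. True}"
    unfolding O_rel_def first last using mid by (intro arg_cong2[where f="(\<union>)"]) (auto; metis)+
  also have "\<dots> = ?R"
  proof (intro equalityI subsetI)
    fix e assume "e \<in> ?R"
    then obtain l i where e: "i \<le> length (\<beta> l)"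
      "e = (vertex \<beta> l i True, vertex \<beta> l (Suc i mod Suc (length (\<beta> l))) False)" by blast
    consider "i = 0" | j where "i = Suc j" "j + 2 \<le> length (\<beta> l)" | "i = length (\<beta> l)"
      using e(1) by (cases i) (auto, linarith)
    then show "e \<in> {(vertex \<beta> l 0 True, vertex \<beta> l 1 False) | l. True} \<union>
      {(vertex \<beta> l (Suc i) True, vertex \<beta> l (Suc (Suc i)) False) | l i. i + 2 \<le> length (\<beta> l)} \<union>
      {(vertex \<beta> l (length (\<beta> l)) True, vertex \<beta> l 0 False) | l. True}"
    proof cases
      case 1
      then show ?thesis using e(2) pos[of l] by auto
    next
      case (2 j)
      then show ?thesis using e(2) by auto
    next
      case 3
      then show ?thesis using e(2) by auto
    qed
  next
    fix e assume "e \<in> {(vertex \<beta> l 0 True, vertex \<beta> l 1 False) | l. True} \<union>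
      {(vertex \<beta> l (Suc i) True, vertex \<beta> l (Suc (Suc i)) False) | l i. i + 2 \<le> length (\<beta> l)} \<union>
      {(vertex \<beta> l (length (\<beta> l)) True, vertex \<beta> l 0 False) | l. True}"
    then consider l where "e = (vertex \<beta> l 0 True, vertex \<beta> l 1 False)"
      | l i where "e = (vertex \<beta> l (Suc i) True, vertex \<beta> l (Suc (Suc i)) False)" "i + 2 \<le> length (\<beta> l)"
      | l where "e = (vertex \<beta> l (length (\<beta> l)) True, vertex \<beta> l 0 False)" by blast
    then show "e \<in> ?R"
    proof cases
      case (1 l)
      then show ?thesis using pos[of l] by (force intro: exI[of _ "0::nat"])
    next
      case (2 l i)
      then show ?thesis
        unfolding mem_Collect_eq by (intro exI[of _ l] exI[of _ "Suc i"]) simp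
    next
      case (3 l)
      then show ?thesis
        unfolding mem_Collect_eq by (intro exI[of _ l] exI[of _ "length (\<beta> l)"]) simp
    qed
  qed
  finally show ?thesis .
qed

lemma cyclic_predecessor:
  assumes "i \<le> m"
  shows "\<exists>j \<le> m. i = Suc j mod Suc m"
proof (cases i)
  case 0
  then show ?thesis by (intro exI[of _ m]) simp
next
  case (Suc j)
  then show ?thesis using assms by (intro exI[of _ j]) simp
qed

lemma fst_G_rel_eq:
  assumes "\<beta> \<in> J_seqs"
  shows "fst ` G_rel \<beta> = {vertex \<beta> l i b | l i b. i \<le> length (\<beta> l)}"
proof (intro equalityI subsetI)
  fix z assume "z \<in> fst ` G_rel \<beta>"
  then obtain l i where "i \<le> length (\<beta> l)"
    "z = vertex \<beta> l i True \<or> z = vertex \<beta> l (Suc i mod Suc (length (\<beta> l))) False"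
    unfolding G_rel_def O_rel_eq[OF assms] by auto
  moreover have "Suc i mod Suc (length (\<beta> l)) \<le> length (\<beta> l)"
    by (meson less_Suc_eq_le mod_less_divisor zero_less_Suc)
  ultimately show "z \<in> {vertex \<beta> l i b | l i b. i \<le> length (\<beta> l)}" by blast
next
  fix z assume "z \<in> {vertex \<beta> l i b | l i b. i \<le> length (\<beta> l)}"
  then obtain l i b where z: "i \<le> length (\<beta> l)" "z = vertex \<beta> l i b" by blast
  have out: "vertex \<beta> l j True \<in> fst ` O_rel \<beta>" "vertex \<beta> l (Suc j mod Suc (length (\<beta> l))) False \<in> snd ` O_rel \<beta>"
    if "j \<le> length (\<beta> l)" for j
    using that unfolding O_rel_eq[OF assms] by force+
  have "\<exists>j \<le> length (\<beta> l). i = Suc j mod Suc (length (\<beta> l))"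
    using z(1) by (rule cyclic_predecessor)
  then have "vertex \<beta> l i False \<in> snd ` O_rel \<beta>" using out(2) by blast
  then show "z \<in> fst ` G_rel \<beta>"
    using out(1)[OF z(1)] z(2) unfolding G_rel_def by (cases b) (auto simp: image_Un fst_eq_Domain snd_eq_Range)
qed

lemma K_subspace_eq:
  "K_subspace \<beta> = subtopology seq_space (seq_space closure_of (fst ` G_rel \<beta>))"
  unfolding K_subspace_def K_space_def ..

text \<open>The first letter a or a-bar of a vertex is at position \<open>l + 1\<close> and determines \<open>b\<close>. The
  length of the run that it starts determines \<open>i\<close> up to the coincidence of 0 and 1, which the
  letter c resolves.\<close>

lemma vertex_inject:
  assumes "vertex \<beta> l i b = vertex \<beta> l' i' b'"
  shows "l = l' \<and> i = i' \<and> b = b'"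
proof -
  have eq: "vertex \<beta> l i b n = vertex \<beta> l' i' b' n" for n using assms by simp
  have low: "n \<le> l \<longleftrightarrow> vertex \<beta> l i b n \<notin> {La, La_bar}" for n l i b
    unfolding vertex_def by auto
  have "l = l'" using low eq by (metis dual_order.antisym order_refl)
  moreover have "b = b'"
    using eq[of "Suc l"] \<open>l = l'\<close> unfolding vertex_def by (auto split: if_splits)
  moreover have "n \<le> max 1 i \<longleftrightarrow> n \<le> max 1 i'" if "0 < n" for n
    using eq[of "l + n"] \<open>l = l'\<close> \<open>b = b'\<close> that unfolding vertex_def by (auto split: if_splits)
  then have "max 1 i = max 1 i'"
    by (metis dual_order.antisym less_le_trans max.cobounded1 order_refl zero_less_one)
  moreover have "i = 0 \<longleftrightarrow> i' = 0"
    using eq[of 0] unfolding vertex_def by (auto split: if_splits)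
  ultimately show ?thesis by (auto simp: max_def split: if_splits)
qed

text \<open>By compactness a continuous colouring is constant on cylinders of some length \<open>l\<close>. It then
  gives the same colour to the two halves of a vertex of the \<open>l\<close>-th cycle, so it induces a
  colouring of this odd cycle.\<close>

lemma K_subspace_not_two_colourable:
  assumes \<beta>: "\<beta> \<in> J_seqs"
    and c: "continuous_map (K_subspace \<beta>) (discrete_topology {i::nat. enat i < 2}) c"
    and edges: "\<forall>(x, y) \<in> G_rel \<beta>. c x \<noteq> c y"
  shows False
proof -
  let ?C = "seq_space closure_of (fst ` G_rel \<beta>)"
  have fin: "finite (UNIV :: letter set)"
  proof -
    have "x \<in> insert Lc (insert La (insert La_bar (range Bit)))" for x by (cases x) auto
    then have "(UNIV :: letter set) \<subseteq> insert Lc (insert La (insert La_bar (range Bit)))" by (rule subsetI)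
    then show ?thesis by (rule finite_subset) simp
  qed
  have "compactin seq_space ?C"
    using closedin_compact_space[OF compact_seq_space[OF fin] closedin_closure_of] .
  then obtain l where l: "\<And>x y. x \<in> ?C \<Longrightarrow> y \<in> ?C \<inter> cylinder l x \<Longrightarrow> c y = c x"
    using discrete_map_depends_on_prefix[OF _ c[unfolded K_subspace_eq]] by blast
  have mem: "vertex \<beta> l i b \<in> ?C" if "i \<le> length (\<beta> l)" for i b
    using that closure_of_subset[of "fst ` G_rel \<beta>" seq_space] fst_G_rel_eq[OF \<beta>] by auto
  define h where "h i = c (vertex \<beta> l i True)" for i
  have h: "c (vertex \<beta> l i False) = h i" if "i \<le> length (\<beta> l)" for i
    unfolding h_def by (rule l) (use mem that in \<open>auto simp: vertex_def cylinder_def\<close>)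
  have neq: "h i \<noteq> h (Suc i mod Suc (length (\<beta> l)))" if "i \<le> length (\<beta> l)" for i
  proof -
    have "(vertex \<beta> l i True, vertex \<beta> l (Suc i mod Suc (length (\<beta> l))) False) \<in> G_rel \<beta>"
      unfolding G_rel_def O_rel_eq[OF \<beta>] using that by blast
    then have "h i \<noteq> c (vertex \<beta> l (Suc i mod Suc (length (\<beta> l))) False)"
      using edges unfolding h_def by blast
    then show ?thesis
      using h[of "Suc i mod Suc (length (\<beta> l))"]
      by (metis less_Suc_eq_le mod_less_divisor zero_less_Suc)
  qed
  have two: "h i < 2" if "i \<le> length (\<beta> l)" for i
  proof -
    have "c (vertex \<beta> l i True) \<in> {i. enat i < 2}"
      using c mem[OF that] unfolding continuous_map K_subspace_eq by auto
    then show ?thesis unfolding h_def by (simp add: numeral_eq_enat)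
  qed
  have "i \<le> length (\<beta> l) \<Longrightarrow> h i = h 0 \<longleftrightarrow> even i" for i
  proof (induction i)
    case (Suc i)
    then have "h i \<noteq> h (Suc i)" using neq[of i] by simp
    then show ?case using Suc two[of i] two[of "Suc i"] two[of 0] by auto
  qed simp
  moreover have "even (length (\<beta> l))" using \<beta> unfolding J_seqs_def by blast
  ultimately show False using neq[of "length (\<beta> l)"] by simp
qed

text \<open>A sequence in the closure that is not a vertex consists of bits only or of the letter c only.
  Placing the vertices near their own bits thus forces the value there: it is the sequence of bits
  itself, or the limit \<open>t\<close> of the places of the vertices 0.\<close>

lemma continuous_extension_from_vertices:
  assumes \<beta>: "\<beta> \<in> J_seqs"
    and bits: "\<And>l i b j. i < length (\<beta> l) \<Longrightarrow> j \<le> l \<Longrightarrow> P l (Suc i) b j = \<beta> l ! i ! j"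
    and c: "\<And>j. \<forall>\<^sub>F l in sequentially. \<forall>b. P l 0 b j = t j"
  shows "\<exists>\<psi>. continuous_map (K_subspace \<beta>) cantor_topology \<psi> \<and>
           (\<forall>l i b. i \<le> length (\<beta> l) \<longrightarrow> \<psi> (vertex \<beta> l i b) = P l i b)"
proof -
  define D where "D = fst ` G_rel \<beta>"
  have D: "D = {vertex \<beta> l i b | l i b. i \<le> length (\<beta> l)}"
    unfolding D_def by (rule fst_G_rel_eq[OF \<beta>])
  define lim where "lim z j = (case z j of Bit u \<Rightarrow> u | _ \<Rightarrow> t j)" for z :: "nat \<Rightarrow> letter" and j
  define \<psi> where "\<psi> z = (if z \<in> D then
      SOME y. \<exists>l i b. i \<le> length (\<beta> l) \<and> z = vertex \<beta> l i b \<and> y = P l i b else lim z)" for z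
  have \<psi>_vertex: "\<psi> (vertex \<beta> l i b) = P l i b" if "i \<le> length (\<beta> l)" for l i b
  proof -
    have "vertex \<beta> l i b \<in> D" unfolding D using that by blast
    moreover have "(SOME y. \<exists>l' i' b'. i' \<le> length (\<beta> l') \<and> vertex \<beta> l i b = vertex \<beta> l' i' b' \<and>
        y = P l' i' b') = P l i b"
      by (rule some_equality) (use that in \<open>auto dest: vertex_inject\<close>)
    ultimately show ?thesis unfolding \<psi>_def by simp
  qed
  have "\<exists>n. \<forall>z' \<in> seq_space closure_of D \<inter> cylinder n z. \<psi> z' j = \<psi> z j" for z j
  proof -
    obtain M where M: "j \<le> M" "\<And>l b. l \<ge> M \<Longrightarrow> P l 0 b j = t j"
      using c[of j] unfolding eventually_sequentially by (metis nat_le_linear order_trans)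
    show ?thesis
    proof (cases "\<exists>k \<le> Suc M. z k \<in> {La, La_bar}")
      case True
      \<comment> \<open>Only the finitely many vertices of the first cycles come near \<open>z\<close>, and each of
        them other than \<open>z\<close> stays away from some cylinder around it.\<close>
      then obtain k where k: "k \<le> Suc M" "z k \<in> {La, La_bar}" by blast
      define F where "F = (\<Union>l\<in>{..M}. (\<lambda>(i, b). vertex \<beta> l i b) ` ({..length (\<beta> l)} \<times> UNIV))"
      have "finite F" unfolding F_def by auto
      have "\<exists>m. v = z \<or> v m \<noteq> z m" for v by blast
      then obtain m where m: "\<And>v. v = z \<or> v (m v) \<noteq> z (m v)" by metis
      define n where "n = Max (insert (Suc M) (m ` F))"
      have n: "Suc M \<le> n" "\<And>v. v \<in> F \<Longrightarrow> m v \<le> n"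
        using \<open>finite F\<close> unfolding n_def by auto
      have "z' = z" if z': "z' \<in> seq_space closure_of D" "z' \<in> cylinder (Suc n) z" for z'
      proof
        fix q
        obtain v where v: "v \<in> D" "v \<in> cylinder (Suc n + Suc q) z'"
          using z'(1) unfolding in_closure_of_seq_space by blast
        then obtain l i b where lib: "i \<le> length (\<beta> l)" "v = vertex \<beta> l i b" unfolding D by blast
        have vz: "v k = z k" if "k < Suc n" for k
          using in_cylinderD[OF v(2), of k] in_cylinderD[OF z'(2), of k] that by simp
        have "v k \<in> {La, La_bar}" using vz k n(1) by auto
        then have "l \<le> M" using k(1) unfolding lib(2) vertex_def by (auto split: if_splits)
        then have "v \<in> F" unfolding F_def using lib by auto
        then have "v = z" using m[of v] n(2)[of v] vz[of "m v"] by auto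
        then show "z' q = z q" using in_cylinderD[OF v(2), of q] by simp
      qed
      then show ?thesis by blast
    next
      case False
      have "\<psi> u j = lim u j" if u: "\<forall>k \<le> Suc M. u k \<notin> {La, La_bar}" for u
      proof (cases "u \<in> D")
        case True
        then obtain l i b where lib: "i \<le> length (\<beta> l)" "u = vertex \<beta> l i b" unfolding D by blast
        have "Suc l > Suc M"
        proof (rule ccontr)
          assume "\<not> Suc l > Suc M"
          then show False
            using u[rule_format, of "Suc l"] unfolding lib(2) vertex_def by (cases b) auto
        qed
        then have "l \<ge> M" "j \<le> l" using M(1) by auto
        then show ?thesis
          using \<psi>_vertex[OF lib(1), of b] M(2)[of l b] bits[of "i - 1" l j b] lib
          unfolding lim_def vertex_def by (cases i) auto
      next
        case False
        then show ?thesis unfolding \<psi>_def by simp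
      qed
      moreover have "\<forall>k \<le> Suc M. z' k \<notin> {La, La_bar}" if "z' \<in> cylinder (Suc (Suc M)) z" for z'
        using in_cylinderD[OF that] False by auto
      moreover have "lim z' j = lim z j" if "z' \<in> cylinder (Suc (Suc M)) z" for z'
        using in_cylinderD[OF that, of j] M(1) unfolding lim_def by simp
      ultimately have "\<psi> z' j = \<psi> z j" if "z' \<in> cylinder (Suc (Suc M)) z" for z'
        using that False by metis
      then show ?thesis by blast
    qed
  qed
  then have "continuous_map (K_subspace \<beta>) cantor_topology \<psi>"
    unfolding K_subspace_eq cantor_topology_def D_def[symmetric]
    by (intro continuous_map_seq_spaceI) blast
  then show ?thesis using \<psi>_vertex by blast
qed

text \<open>Seen through the embedding, the extension takes its values in the image of \<open>X\<close> because this
  image is closed and contains the images of the vertices, which are dense.\<close>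

lemma cont_reducible_if_vertices_placed:
  assumes e: "embedding_map X cantor_topology e" "closedin cantor_topology (e ` topspace X)"
    and G: "graph_on X G" and \<beta>: "\<beta> \<in> J_seqs"
    and edge: "\<And>l i. i \<le> length (\<beta> l) \<Longrightarrow>
                 (p l i True, p l (Suc i mod Suc (length (\<beta> l))) False) \<in> G"
    and bits: "\<And>l i b j. i < length (\<beta> l) \<Longrightarrow> j \<le> l \<Longrightarrow> e (p l (Suc i) b) j = \<beta> l ! i ! j"
    and c: "\<And>j. \<forall>\<^sub>F l in sequentially. \<forall>b. e (p l 0 b) j = t j"
  shows "cont_reducible (K_subspace \<beta>) (G_rel \<beta>) X G"
proof -
  let ?Y = "e ` topspace X"
  obtain \<psi> where \<psi>: "continuous_map (K_subspace \<beta>) cantor_topology \<psi>"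
      "\<And>l i b. i \<le> length (\<beta> l) \<Longrightarrow> \<psi> (vertex \<beta> l i b) = e (p l i b)"
    using continuous_extension_from_vertices[OF \<beta>, of "\<lambda>l i b. e (p l i b)" t] bits c by blast
  obtain g where g: "continuous_map (subtopology cantor_topology ?Y) X g"
      "\<And>x. x \<in> topspace X \<Longrightarrow> g (e x) = x"
    using e(1) unfolding embedding_map_def homeomorphic_map_maps homeomorphic_maps_def by blast
  have p: "p l i b \<in> topspace X" if i: "i \<le> length (\<beta> l)" for l i b
  proof (cases b)
    case True
    then show ?thesis using edge[OF i] G unfolding graph_on_def digraph_on_def by auto
  next
    case False
    obtain j where "j \<le> length (\<beta> l)" "i = Suc j mod Suc (length (\<beta> l))"
      using cyclic_predecessor[OF i] by blast
    then show ?thesis using edge[of j l] False G unfolding graph_on_def digraph_on_def by auto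
  qed
  have "\<psi> z \<in> ?Y" if z: "z \<in> topspace (K_subspace \<beta>)" for z
  proof -
    let ?D = "fst ` G_rel \<beta>"
    have sub: "?D \<subseteq> seq_space closure_of ?D" by (simp add: closure_of_subset)
    have "z \<in> K_subspace \<beta> closure_of ?D"
      using z sub unfolding K_subspace_eq closure_of_subtopology by (simp add: Int_absorb1)
    then have "\<psi> z \<in> cantor_topology closure_of (\<psi> ` ?D)"
      using continuous_map_image_closure_subset[OF \<psi>(1)] by blast
    moreover have "\<psi> ` ?D \<subseteq> ?Y" unfolding fst_G_rel_eq[OF \<beta>] using \<psi>(2) p by auto
    ultimately show ?thesis using closure_of_minimal[OF _ e(2)] by blast
  qed
  then have "continuous_map (K_subspace \<beta>) (subtopology cantor_topology ?Y) \<psi>"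
    using \<psi>(1) by (auto intro: continuous_map_into_subtopology)
  then have cont: "continuous_map (K_subspace \<beta>) X (g \<circ> \<psi>)"
    using g(1) continuous_map_compose by blast
  have val: "(g \<circ> \<psi>) (vertex \<beta> l i b) = p l i b" if "i \<le> length (\<beta> l)" for l i b
    using that \<psi>(2) g(2) p by simp
  have "map_prod (g \<circ> \<psi>) (g \<circ> \<psi>) a \<in> G" if a_edge: "a \<in> O_rel \<beta>" for a
  proof -
    obtain l i where i: "i \<le> length (\<beta> l)"
      and a: "a = (vertex \<beta> l i True, vertex \<beta> l (Suc i mod Suc (length (\<beta> l))) False)"
      using a_edge unfolding O_rel_eq[OF \<beta>] by blast
    have "Suc i mod Suc (length (\<beta> l)) \<le> length (\<beta> l)"
      by (meson less_Suc_eq_le mod_less_divisor zero_less_Suc)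
    then show ?thesis
      using edge[OF i] unfolding a map_prod_simp by (simp only: val[OF i] val)
  qed
  then have O: "((g \<circ> \<psi>) u, (g \<circ> \<psi>) v) \<in> G" if "(u, v) \<in> O_rel \<beta>" for u v
    using that by (metis map_prod_simp)
  moreover have "sym G" using G unfolding graph_on_def by blast
  ultimately have "((g \<circ> \<psi>) u, (g \<circ> \<psi>) v) \<in> G" if "(u, v) \<in> G_rel \<beta>" for u v
    using that symD[of G] unfolding G_rel_def by (metis Un_iff converseD)
  then have "G_rel \<beta> \<subseteq> map_prod (g \<circ> \<psi>) (g \<circ> \<psi>) -` G" by auto
  then show ?thesis unfolding cont_reducible_def using cont by blast
qed


section \<open>The dichotomy\<close>

text \<open>The numerical content lies in monotonicity: colours below a smaller cardinal are colours below
  a larger one. The value \<open>2\<^sup>\<aleph>\<^sup>0\<close> for graphs without any colouring is infinite.\<close>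

lemma ccn_le_two_iff:
  "(continuous_chromatic_number X G, card_of {..<2::nat}) \<in> ordLeq \<longleftrightarrow> continuously_colourable X G 2"
proof
  assume col: "continuously_colourable X G 2"
  then have "(LEAST \<kappa>. continuously_colourable X G \<kappa>) \<le> 2" by (rule Least_le)
  then have sub: "{i. enat i < (LEAST \<kappa>. continuously_colourable X G \<kappa>)} \<subseteq> {..<2}"
    by (auto simp: numeral_eq_enat dest: order.strict_trans2)
  have "(card_of ((\<lambda>i::nat. {i}) ` {i. enat i < (LEAST \<kappa>. continuously_colourable X G \<kappa>)}),
      card_of {..<2::nat}) \<in> ordLeq"
    by (rule card_of_ordLeqI[of the_elem]) (use sub in \<open>auto simp: inj_on_def\<close>)
  then show "(continuous_chromatic_number X G, card_of {..<2::nat}) \<in> ordLeq"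
    unfolding continuous_chromatic_number_def using col by auto
next
  assume le: "(continuous_chromatic_number X G, card_of {..<2::nat}) \<in> ordLeq"
  show "continuously_colourable X G 2"
  proof (cases "\<exists>\<kappa>. continuously_colourable X G \<kappa>")
    case False
    have "(card_of (UNIV :: nat set set), card_of {..<2::nat}) \<in> ordLeq"
      using le unfolding continuous_chromatic_number_def if_not_P[OF False] .
    then have "finite (UNIV :: nat set set)" using card_of_ordLeq_finite by blast
    then show ?thesis by (simp add: Finite_Set.finite_set)
  next
    case True
    define L where "L = (LEAST \<kappa>. continuously_colourable X G \<kappa>)"
    have L: "continuously_colourable X G L" unfolding L_def using True by (rule LeastI_ex)
    have "(card_of ((\<lambda>i::nat. {i}) ` {i. enat i < L}), card_of {..<2::nat}) \<in> ordLeq"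
      using le unfolding continuous_chromatic_number_def if_P[OF True] L_def .
    then obtain f where f: "inj_on f ((\<lambda>i::nat. {i}) ` {i. enat i < L})"
        "f ` ((\<lambda>i::nat. {i}) ` {i. enat i < L}) \<subseteq> {..<2::nat}"
      unfolding card_of_ordLeq[symmetric] by blast
    then have fin: "finite ((\<lambda>i::nat. {i}) ` {i. enat i < L})"
      using inj_on_finite[OF f] by blast
    have card: "card ((\<lambda>i::nat. {i}) ` {i. enat i < L}) \<le> 2"
      using card_inj_on_le[OF f] by simp
    have "L \<le> 2"
    proof (rule ccontr)
      assume "\<not> L \<le> 2"
      then have "enat i < L" if "i \<le> 2" for i
        using that order.strict_trans1[of "enat i" 2 L] by (simp add: numeral_eq_enat not_le)
      then have "(\<lambda>i::nat. {i}) ` {0, 1, 2} \<subseteq> (\<lambda>i::nat. {i}) ` {i. enat i < L}"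
        by (intro image_mono) auto
      from card_mono[OF fin this] card show False by (simp add: card_image)
    qed
    obtain c where c: "continuous_map X (discrete_topology {i. enat i < L}) c" "\<forall>(x, y)\<in>G. c x \<noteq> c y"
      using L unfolding continuously_colourable_def by blast
    have "{i. enat i < L} \<subseteq> {i. enat i < 2}" using \<open>L \<le> 2\<close> by (auto dest: order.strict_trans2)
    then have "continuous_map X (subtopology (discrete_topology {i. enat i < 2}) {i. enat i < L}) c"
      using c(1) by (simp add: Int_absorb1)
    then have "continuous_map X (discrete_topology {i. enat i < 2}) c"
      by (rule continuous_map_into_fulltopology)
    then show ?thesis unfolding continuously_colourable_def using c(2) by blast
  qed
qed

lemma prefix_colouring_continuously_colourable:
  fixes c :: "bool list \<Rightarrow> bool"
  assumes e: "continuous_map X cantor_topology e" and "G \<subseteq> topspace X \<times> topspace X"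
    and c: "\<forall>(x, y)\<in>G. c (map (e x) [0..<n]) \<noteq> c (map (e y) [0..<n])"
  shows "continuously_colourable X G 2"
proof -
  define f where "f x = (if c (map (e x) [0..<n]) then 0 else 1 :: nat)" for x
  have "continuous_map X (discrete_topology {i. enat i < 2}) f"
    unfolding continuous_map
  proof (intro conjI allI impI)
    fix U :: "nat set"
    have "openin cantor_topology {w. (if c (map w [0..<n]) then 0 else 1) \<in> U}"
      unfolding cantor_topology_def openin_seq_space_iff
    proof
      fix w assume w: "w \<in> {w. (if c (map w [0..<n]) then 0 else 1) \<in> U}"
      have "v \<in> {w. (if c (map w [0..<n]) then 0 else 1) \<in> U}" if v: "v \<in> cylinder n w" for v
      proof -
        have "map v [0..<n] = map w [0..<n]" using in_cylinderD[OF v] by simp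
        then show ?thesis using w by (simp del: map_eq_conv)
      qed
      then have "cylinder n w \<subseteq> {w. (if c (map w [0..<n]) then 0 else 1) \<in> U}" by blast
      then show "\<exists>m. cylinder m w \<subseteq> {w. (if c (map w [0..<n]) then 0 else 1) \<in> U}" by blast
    qed
    then show "openin X {x \<in> topspace X. f x \<in> U}"
      using openin_continuous_map_preimage[OF e] unfolding f_def by fastforce
  qed (auto simp: f_def numeral_eq_enat one_enat_def zero_enat_def)
  moreover have "\<forall>(x, y)\<in>G. f x \<noteq> f y" using c unfolding f_def by auto
  ultimately show ?thesis unfolding continuously_colourable_def by blast
qed

text \<open>The subsequence \<open>r\<close> is strictly increasing, so the \<open>r l\<close>-th pseudo-cycle closes up to
  prefixes of length \<open>r l + 1 \<ge> l + 1\<close> and can be used with words of length \<open>l + 1\<close>.\<close>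

lemma reducible_if_not_two_colourable:
  assumes X: "zero_dim_metrizable_compact X" and G: "graph_on X G"
    and notcol: "\<not> continuously_colourable X G 2"
  shows "\<exists>\<beta>\<in>J_conv. cont_reducible (K_subspace \<beta>) (G_rel \<beta>) X G"
proof -
  obtain e where e: "embedding_map X cantor_topology e" "closedin cantor_topology (e ` topspace X)"
    using zero_dim_metrizable_compact_embeds_in_cantor[OF X] by blast
  have "sym G" "G \<subseteq> topspace X \<times> topspace X"
    using G unfolding graph_on_def digraph_on_def by auto
  have cont: "continuous_map X cantor_topology e"
    using homeomorphic_imp_continuous_map[OF e(1)[unfolded embedding_map_def]]
    by (simp add: continuous_map_in_subtopology)
  define pre where "pre l x = map (e x) [0..<Suc l]" for l x
  have "\<nexists>c :: bool list \<Rightarrow> bool. \<forall>(x, y)\<in>G. c (pre l x) \<noteq> c (pre l y)" for l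
  proof
    assume "\<exists>c :: bool list \<Rightarrow> bool. \<forall>(x, y)\<in>G. c (pre l x) \<noteq> c (pre l y)"
    then obtain c :: "bool list \<Rightarrow> bool" where c: "\<forall>(x, y)\<in>G. c (pre l x) \<noteq> c (pre l y)" by (rule exE)
    have "continuously_colourable X G 2"
      using c unfolding pre_def by (rule prefix_colouring_continuously_colourable[OF cont \<open>G \<subseteq> _\<close>])
    with notcol show False by (rule notE)
  qed
  then have "\<forall>l. \<exists>N. odd N \<and> (\<forall>k. \<exists>x y. \<forall>i < N + 2 * k.
      (x i, y i) \<in> G \<and> pre l (y i) = pre l (x (Suc i mod (N + 2 * k))))"
    by (intro allI two_colouring_or_odd_pseudo_cycle[OF \<open>sym G\<close>])
  then obtain N where "\<forall>l. odd (N l) \<and> (\<forall>k. \<exists>x y. \<forall>i < N l + 2 * k.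
      (x i, y i) \<in> G \<and> pre l (y i) = pre l (x (Suc i mod (N l + 2 * k))))"
    by (rule choice[THEN exE])
  then have N: "odd (N l)" "\<exists>x y. \<forall>i < N l + 2 * k.
      (x i, y i) \<in> G \<and> pre l (y i) = pre l (x (Suc i mod (N l + 2 * k)))" for l k
    by simp_all
  \<comment> \<open>Lengths that increase with \<open>l\<close> remain nondecreasing and unbounded along subsequences.\<close>
  define L where "L l = 2 * (\<Sum>j\<le>l. Suc (N j)) + 1" for l
  have L: "odd (L l)" "2 * l + 3 \<le> L l" "strict_mono L" for l
  proof -
    show "odd (L l)" unfolding L_def by simp
    have "(\<Sum>j\<le>l. 1) \<le> (\<Sum>j\<le>l. Suc (N j))" by (rule sum_mono) simp
    then show "2 * l + 3 \<le> L l" unfolding L_def by simp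
    show "strict_mono L" unfolding strict_mono_Suc_iff L_def by simp
  qed
  have "\<exists>x y. \<forall>i < L l. (x i, y i) \<in> G \<and> pre l (y i) = pre l (x (Suc i mod L l))" for l
  proof -
    have "N l \<le> (\<Sum>j\<le>l. Suc (N j))"
      using member_le_sum[of l "{..l}" "\<lambda>j. Suc (N j)"] by simp
    then have "N l \<le> L l" "even (L l - N l)" using N(1)[of l] L(1)[of l] unfolding L_def by auto
    then have "L l = N l + 2 * ((L l - N l) div 2)" by simp
    then show ?thesis using N(2)[of l "(L l - N l) div 2"] by simp
  qed
  then have "\<forall>l. \<exists>x y. \<forall>i < L l. (x i, y i) \<in> G \<and> pre l (y i) = pre l (x (Suc i mod L l))"
    by (rule allI)
  from choice[OF this] obtain x where
    "\<forall>l. \<exists>y. \<forall>i < L l. (x l i, y i) \<in> G \<and> pre l (y i) = pre l (x l (Suc i mod L l))" by (rule exE)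
  from choice[OF this] obtain y where
    "\<forall>l. \<forall>i < L l. (x l i, y l i) \<in> G \<and> pre l (y l i) = pre l (x l (Suc i mod L l))" by (rule exE)
  then have xy: "\<And>l i. i < L l \<Longrightarrow> (x l i, y l i) \<in> G"
      "\<And>l i. i < L l \<Longrightarrow> pre l (y l i) = pre l (x l (Suc i mod L l))" by simp_all
  from pointwise_eventually_constant_subsequence[of "\<lambda>l k. e (x l (fst k)) (snd k)"]
  obtain r :: "nat \<Rightarrow> nat" where r: "strict_mono r"
      "\<forall>k. \<exists>b. \<forall>\<^sub>F l in sequentially. e (x (r l) (fst k)) (snd k) = b"
    by (elim exE conjE)
  from choice[OF r(2)] obtain T' where
      T': "\<forall>k. \<forall>\<^sub>F l in sequentially. e (x (r l) (fst k)) (snd k) = T' k" by (rule exE)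
  define T where "T i j = T' (i, j)" for i j
  have T: "\<forall>\<^sub>F l in sequentially. e (x (r l) i) j = T i j" for i j
    using T'[rule_format, of "(i, j)"] unfolding T_def by simp
  define \<beta> where "\<beta> l = map (\<lambda>i. pre l (x (r l) (Suc i))) [0..<L (r l) - 1]" for l
  have len: "length (\<beta> l) = L (r l) - 1" "Suc (length (\<beta> l)) = L (r l)" for l
    unfolding \<beta>_def using L(2)[of "r l"] by simp_all
  have \<beta>_nth: "\<beta> l ! i = pre l (x (r l) (Suc i))" if "i < length (\<beta> l)" for l i
    using that unfolding \<beta>_def by simp
  have \<beta>: "\<beta> \<in> J_seqs"
    unfolding J_seqs_def
  proof (intro CollectI conjI allI impI)
    show "mono (\<lambda>l. length (\<beta> l))"
      unfolding len by (intro monoI diff_le_mono)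
        (metis L(3) r(1) strict_mono_less_eq)
    show "\<exists>l. n < length (\<beta> l)" for n
      using L(2)[of "r n"] seq_suble[OF r(1), of n] len(1)[of n] by (intro exI[of _ n]) linarith
    show "0 < length (\<beta> l)" for l using L(2)[of "r l"] len(1)[of l] by linarith
    show "even (length (\<beta> l))" for l using L(1)[of "r l"] len(2)[of l] by (metis even_Suc)
    show "length (\<beta> l ! i) = l + 1" if "i < length (\<beta> l)" for l i
      using \<beta>_nth[OF that] unfolding pre_def by simp
  qed
  have "\<beta> \<in> J_conv"
    unfolding J_conv_def
  proof (intro CollectI conjI allI)
    fix i
    have ev: "\<forall>\<^sub>F l in sequentially. i < length (\<beta> l) \<longrightarrow> ((\<beta> l ! i) \<frown> (\<lambda>_. False)) j = T (Suc i) j" for j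
      using eventually_ge_at_top[of j] T[of "Suc i" j]
    proof eventually_elim
      case (elim l)
      then show ?case
        using \<beta>_nth[of i l] unfolding pre_def conc_def by (simp del: upt_Suc)
    qed
    have "\<forall>\<^sub>F l in sequentially. i < length (\<beta> l) \<longrightarrow> ((\<beta> l ! i) \<frown> (\<lambda>_. False)) j \<in> U"
      if "T (Suc i) j \<in> U" for j U
      by (rule eventually_mono[OF ev[of j]]) (use that in simp)
    then have "limitin cantor_topology (\<lambda>l. (\<beta> l ! i) \<frown> (\<lambda>_. False)) (T (Suc i))
        (inf sequentially (principal {l. i < length (\<beta> l)}))"
      unfolding cantor_topology_def limitin_componentwise
      by (auto simp: limitin_def eventually_inf_principal)
    then show "\<exists>x. limitin cantor_topology (\<lambda>l. (\<beta> l ! i) \<frown> (\<lambda>_. False)) x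
        (inf sequentially (principal {l. i < length (\<beta> l)}))" by blast
  qed (rule \<beta>)
  \<comment> \<open>The edge that enters vertex \<open>i\<close> is number \<open>i - 1\<close>, cyclically.\<close>
  define p where "p l i b = (if b then x (r l) i else
      y (r l) (if i = 0 then L (r l) - 1 else i - 1))" for l i b
  have near: "e (p l i b) j = e (x (r l) i) j" if ij: "i \<le> length (\<beta> l)" "j \<le> l" for l i b j
  proof -
    have i: "i < L (r l)" using ij(1) len(2)[of l] by linarith
    have "pre (r l) (p l i b) = pre (r l) (x (r l) i)"
    proof (cases "b \<or> i = 0")
      case True
      then show ?thesis
        using xy(2)[of "L (r l) - 1" "r l"] i unfolding p_def by auto
    next
      case False
      then show ?thesis using xy(2)[of "i - 1" "r l"] i unfolding p_def by simp
    qed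
    moreover have "j < Suc (r l)" using ij(2) seq_suble[OF r(1), of l] by linarith
    ultimately show ?thesis unfolding pre_def map_eq_conv by (simp del: upt_Suc)
  qed
  have "cont_reducible (K_subspace \<beta>) (G_rel \<beta>) X G"
  proof (rule cont_reducible_if_vertices_placed[OF e G \<beta>, of p "T 0"])
    fix l i assume "i \<le> length (\<beta> l)"
    then have i: "i < L (r l)" using len(2)[of l] by linarith
    have "p l (Suc i mod L (r l)) False = y (r l) i"
    proof (cases "Suc i = L (r l)")
      case True
      then have "L (r l) - 1 = i" by linarith
      then show ?thesis using True by (simp add: p_def)
    next
      case False
      then show ?thesis using i by (simp add: p_def)
    qed
    then show "(p l i True, p l (Suc i mod Suc (length (\<beta> l))) False) \<in> G"
      using xy(1)[OF i] unfolding len(2) by (simp add: p_def)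
  next
    fix l i b j assume "i < length (\<beta> l)" "j \<le> l"
    then show "e (p l (Suc i) b) j = \<beta> l ! i ! j"
      using near[of "Suc i" l j b] \<beta>_nth[of i l] unfolding pre_def by (simp del: upt_Suc)
  next
    fix j
    show "\<forall>\<^sub>F l in sequentially. \<forall>b. e (p l 0 b) j = T 0 j"
      using eventually_ge_at_top[of j] T[of 0 j] by eventually_elim (simp add: near)
  qed
  then show ?thesis using \<open>\<beta> \<in> J_conv\<close> by blast
qed

theorem theorem3p2p4:
  fixes X :: "'a topology" and G :: "('a \<times> 'a) set"
  assumes "zero_dim_metrizable_compact X"
    and "graph_on X G"
  shows "((continuous_chromatic_number X G, card_of {..<2::nat}) \<in> ordLeq \<or>
          (\<exists>\<beta>\<in>J_conv. cont_reducible (K_subspace \<beta>) (G_rel \<beta>) X G)) \<and>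
         \<not> ((continuous_chromatic_number X G, card_of {..<2::nat}) \<in> ordLeq \<and>
            (\<exists>\<beta>\<in>J_conv. cont_reducible (K_subspace \<beta>) (G_rel \<beta>) X G))"
  unfolding ccn_le_two_iff
proof (intro conjI notI)
  show "continuously_colourable X G 2 \<or> (\<exists>\<beta>\<in>J_conv. cont_reducible (K_subspace \<beta>) (G_rel \<beta>) X G)"
    using reducible_if_not_two_colourable[OF assms] by blast
next
  assume "continuously_colourable X G 2 \<and> (\<exists>\<beta>\<in>J_conv. cont_reducible (K_subspace \<beta>) (G_rel \<beta>) X G)"
  then obtain c \<beta> \<phi> where c: "continuous_map X (discrete_topology {i. enat i < 2}) c"
      "\<forall>(x, y)\<in>G. c x \<noteq> c y" and \<beta>: "\<beta> \<in> J_conv"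
      and \<phi>: "continuous_map (K_subspace \<beta>) X \<phi>" "G_rel \<beta> \<subseteq> map_prod \<phi> \<phi> -` G"
    unfolding continuously_colourable_def cont_reducible_def by blast
  have "\<forall>(x, y)\<in>G_rel \<beta>. (c \<circ> \<phi>) x \<noteq> (c \<circ> \<phi>) y" using c(2) \<phi>(2) by fastforce
  moreover have "\<beta> \<in> J_seqs" using \<beta> unfolding J_conv_def by blast
  ultimately show False
    using K_subspace_not_two_colourable continuous_map_compose[OF \<phi>(1) c(1)] by blast
qed

end
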